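(* Let \[ F_1(x,y) = \frac{x(x-1)}{2} + x + y \qquad\text{and}\qquad G_1(x,y) = \frac{x(x+1)}{2} + x - y . \] Then $F_1$ and $G_1$ are the unique quadratic packing polynomials on the integer sector $I(1) = \{(x,y)\in\mathbf{N}_0^2 : 0\le y\le x\}$; that is, the set of all quadratic packing polynomials on $I(1)$ is exactly $\{F_1, G_1\}$.
   Context: $\mathbf{N}_0$ denotes the set of nonnegative integers. A packing polynomial on an integer sector $I \subseteq \mathbf{N}_0^2$ is a polynomial in two variables (with real coefficients) whose restriction to $I$ is a one-to-one correspondence between $I$ and $\mathbf{N}_0$. Quadratic means of total degree two. *)

theory Defs
  imports Complex_Main "HOL-Computational_Algebra.Polynomial"
begin

text \<open>
  A polynomial in \<open>x\<close> and \<open>y\<close> with real coefficients is an element of \<open>(\<real>[x])[y]\<close>, so the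
  coefficient of \<open>x^i y^j\<close> in \<open>p\<close> is \<open>coeff (coeff p j) i\<close>.
\<close>

type_synonym real_poly2 = "real poly poly"

definition varX :: real_poly2 where
  "varX = [:[:0, 1:]:]"

definition varY :: real_poly2 where
  "varY = [:0, 1:]"

definition eval2 :: "real_poly2 \<Rightarrow> real \<Rightarrow> real \<Rightarrow> real" where
  "eval2 p x y = poly (poly p [:y:]) x"

text \<open>The zero polynomial is given total degree 0, as for \<^const>\<open>degree\<close>.\<close>

definition total_degree :: "real_poly2 \<Rightarrow> nat" where
  "total_degree p = Max (insert 0 {i + j | i j. coeff (coeff p j) i \<noteq> 0})"

definition packing_polynomial_on :: "(nat \<times> nat) set \<Rightarrow> real_poly2 \<Rightarrow> bool" where
  "packing_polynomial_on S p \<longleftrightarrow> bij_betw (\<lambda>(x, y). eval2 p (real x) (real y)) S \<nat>"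

definition quadratic_packing_polynomials :: "(nat \<times> nat) set \<Rightarrow> real_poly2 set" where
  "quadratic_packing_polynomials S = {p. packing_polynomial_on S p \<and> total_degree p = 2}"

definition sector1 :: "(nat \<times> nat) set" where
  "sector1 = {(x, y). 0 \<le> y \<and> y \<le> x}"

definition F1 :: real_poly2 where
  "F1 = smult [:1/2:] (varX * (varX - 1)) + varX + varY"

definition G1 :: real_poly2 where
  "G1 = smult [:1/2:] (varX * (varX + 1)) + varX - varY"

lemma eval2_varX [simp]: "eval2 varX x y = x"
  and eval2_varY [simp]: "eval2 varY x y = y"
  by (simp_all add: eval2_def varX_def varY_def)

lemma eval2_F1: "eval2 F1 x y = x * (x - 1) / 2 + x + y"
  by (simp add: eval2_def F1_def varX_def varY_def field_simps)

lemma eval2_G1: "eval2 G1 x y = x * (x + 1) / 2 + x - y"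
  by (simp add: eval2_def G1_def varX_def varY_def field_simps)

end

theory Submission
  imports Defs "HOL-Library.Nat_Bijection"
begin

text \<open>
  The map \<open>(u, v) \<mapsto> (u + v, v)\<close> identifies the quadrant with the sector, so the claim is the
  Fueter--Polya theorem on quadratic bijections \<open>P\<close> from the quadrant to \<open>\<nat>\<close>. Let \<open>2 P\<close> have
  quadratic part \<open>a x\<^sup>2 + 2 b x y + c y\<^sup>2\<close>. Positivity and injectivity force \<open>a, c > 0\<close>, and
  \<open>b\<^sup>2 < a c\<close> if \<open>b < 0\<close>. Hence \<open>P \<le> n\<^sup>2\<close> confines \<open>x + y\<close> to \<open>O(n)\<close>, where a bounded shift of
  \<open>(x, y)\<close> changes \<open>P\<close> by \<open>O(n)\<close> only; as \<open>P\<close> is a bijection, the points with \<open>P < n\<^sup>2\<close> are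
  equidistributed among the residue classes modulo any \<open>M\<close>. Consequently \<open>P\<close> takes every value
  modulo an odd \<open>M\<close> on at most \<open>M\<close> of the \<open>M\<^sup>2\<close> classes. If \<open>D = a c - b\<^sup>2 \<noteq> 0\<close>, this fails for
  \<open>M = \<bar>4 D a\<^sup>2 + 1\<bar>\<close>, modulo which the quadratic part splits into two lines through a critical
  point. So \<open>b\<^sup>2 = a c\<close>, and counting the points with \<open>P < N\<close>, which lie in a triangle
  \<open>a x + b y \<le> t\<close>, gives \<open>a = b = c = 1\<close>. The linear coefficients are then pinned down by
  explicit collisions between neighbouring antidiagonals.
\<close>

text \<open>Doubling clears the denominators: second differences of an integer-valued quadratic
  polynomial are integers. The coefficient of \<open>x * y\<close> in \<open>P\<close> is itself a
  mixed difference, whence the even coefficient \<open>2 * b\<close>.\<close>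

locale quadratic_pairing =
  fixes P :: "nat \<Rightarrow> nat \<Rightarrow> nat" and a b c d e f :: int
  assumes P_eq: "2 * int (P x y) = a * int x ^ 2 + 2 * b * int x * int y + c * int y ^ 2
      + d * int x + e * int y + 2 * f"
    and P_inj: "P x y = P x' y' \<Longrightarrow> x = x' \<and> y = y'"
    and P_surj: "\<exists>x y. P x y = n"
begin

text \<open>Transfers every statement about \<open>a\<close> to \<open>c\<close>, through the
  interpretations named \<open>sw\<close>.\<close>

lemma swap: "quadratic_pairing (\<lambda>x y. P y x) c b a e d f"
proof
  show "2 * int (P y x) = c * int x ^ 2 + 2 * b * int x * int y + a * int y ^ 2
      + e * int x + d * int y + 2 * f" for x y
    by (simp add: P_eq)
qed (use P_inj P_surj in blast)+

section \<open>Sign conditions on the quadratic part\<close>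

lemma P_00: "int (P 0 0) = f"
  using P_eq[of 0 0] by simp

text \<open>If \<open>a < 0\<close>, then \<open>P\<close> becomes negative far out on the x-axis.
  If \<open>a = 0\<close>, the values on that axis form an arithmetic progression, and a suitable
  parallel row runs into it, against injectivity.\<close>

lemma leading_coeff_pos: "a \<ge> 1"
proof -
  have "a \<ge> 0"
  proof (rule ccontr)
    assume "\<not> a \<ge> 0"
    define x where "x = nat (\<bar>d\<bar> + 2 * \<bar>f\<bar> + 1)"
    have x: "int x = \<bar>d\<bar> + 2 * \<bar>f\<bar> + 1" by (simp add: x_def)
    have "a * int x ^ 2 \<le> - 1 * int x ^ 2"
      using \<open>\<not> a \<ge> 0\<close> by (intro mult_right_mono) auto
    also have "\<dots> = - (\<bar>d\<bar> * int x) - 2 * \<bar>f\<bar> * int x - int x"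
      by (simp add: x power2_eq_square algebra_simps)
    finally have 1: "a * int x ^ 2 \<le> - (\<bar>d\<bar> * int x) - 2 * \<bar>f\<bar> * int x - int x" .
    have 2: "d * int x \<le> \<bar>d\<bar> * int x" by (intro mult_right_mono) auto
    have 3: "2 * \<bar>f\<bar> * 1 \<le> 2 * \<bar>f\<bar> * int x" using x by (intro mult_left_mono) auto
    have "0 \<le> a * int x ^ 2 + d * int x + 2 * f" using P_eq[of x 0] by simp
    with 1 2 3 x show False by linarith
  qed
  moreover have "a \<noteq> 0"
  proof
    assume a0: "a = 0"
    define d' where "d' = int (P 1 0) - int (P 0 0)"
    have d: "d = 2 * d'" using P_eq[of 1 0] P_00 a0 by (simp add: d'_def)
    have P0: "int (P x 0) = f + d' * int x" for x using P_eq[of x 0] a0 d by simp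
    have "d' \<ge> 0"
    proof (rule ccontr)
      assume "\<not> d' \<ge> 0"
      then have "d' * int (nat \<bar>f\<bar> + 1) \<le> - 1 * int (nat \<bar>f\<bar> + 1)"
        by (intro mult_right_mono) auto
      then have "int (P (nat \<bar>f\<bar> + 1) 0) \<le> - 1" unfolding P0 by simp
      then show False by linarith
    qed
    moreover have "d' \<noteq> 0" using P_inj[of 1 0 0 0] by (auto simp: d'_def)
    ultimately have d': "d' > 0" by simp
    \<comment> \<open>On this row every value is congruent to \<open>f\<close> modulo
      \<open>d'\<close>; the factor 2 cancels the halves in the coefficients of \<open>P\<close>.
      Injectivity keeps the row from staying below \<open>P 0 0\<close>, so it meets the
      progression.\<close>
    define y where "y = nat (2 * d')"
    have y: "int y = 2 * d'" using d' by (simp add: y_def)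
    have "\<exists>x. P x y \<ge> P 0 0"
    proof (rule ccontr)
      assume "\<not> ?thesis"
      then have "range (\<lambda>x. P x y) \<subseteq> {..<P 0 0}" by (auto simp: not_le)
      then have "finite (range (\<lambda>x. P x y))" using finite_subset by blast
      moreover have "inj (\<lambda>x. P x y)" by (rule injI) (use P_inj in blast)
      ultimately show False using finite_imageD by blast
    qed
    then obtain x where x: "P x y \<ge> P 0 0" by blast
    define t where "t = 2 * b * int x + 2 * c * d' + int x + e"
    have "2 * int (P x y) = 2 * (f + d' * t)"
      unfolding P_eq y t_def by (simp add: a0 d power2_eq_square algebra_simps)
    then have *: "int (P x y) = f + d' * t" by simp
    with x P_00 have "d' * t \<ge> 0" by linarith
    with d' have "t \<ge> 0" by (simp add: zero_le_mult_iff)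
    with * P0[of "nat t"] have "P x y = P (nat t) 0" by simp
    with P_inj have "y = 0" by blast
    with y d' show False by simp
  qed
  ultimately show ?thesis by simp
qed

text \<open>The vector \<open>(c, - b)\<close> lies in the quadrant when \<open>b < 0\<close> and is
  orthogonal to \<open>(0, 1)\<close> for the quadratic form, so the increment does not involve
  \<open>y\<close>. The form takes the value \<open>c * (a * c - b\<^sup>2)\<close> on it.\<close>

lemma P_add_multiple:
  assumes "u = nat c" "v = nat (- b)" "b < 0" "c \<ge> 1"
  shows "2 * int (P (x + t * u) (y + t * v)) = 2 * int (P x y)
     + c * (a * c - b\<^sup>2) * int t ^ 2 + int t * (2 * (a * c - b\<^sup>2) * int x + d * c - e * b)"
proof -
  have uv: "int u = c" "int v = - b" using assms by auto
  show ?thesis unfolding P_eq of_nat_add of_nat_mult uv by algebra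
qed

text \<open>In the direction \<open>(c, - b)\<close> an indefinite form would drive \<open>P\<close>
  below 0. A degenerate form makes each step from the x-axis add the same constant
  \<open>l'\<close>, positive by injectivity. Two of the \<open>l' + 1\<close> first axis points
  then agree modulo \<open>l'\<close>, and steps from the one with the smaller value reach the value
  of the other.\<close>

lemma discriminant_of_neg:
  assumes "b < 0"
  shows "b\<^sup>2 < a * c"
proof (rule ccontr)
  assume "\<not> b\<^sup>2 < a * c"
  interpret sw: quadratic_pairing "\<lambda>x y. P y x" c b a e d f by (rule swap)
  have c: "c \<ge> 1" by (rule sw.leading_coeff_pos)
  define u v where "u = nat c" and "v = nat (- b)"
  define l where "l = d * c - e * b"
  note shift = P_add_multiple[OF u_def v_def assms c]
  have v: "v > 0" using assms by (simp add: v_def)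
  show False
  proof (cases "b\<^sup>2 = a * c")
    case False
    define D where "D = b\<^sup>2 - a * c"
    have "D > 0" using False \<open>\<not> b\<^sup>2 < a * c\<close> by (simp add: D_def)
    then have cD: "c * D \<ge> 1" using c by (simp add: int_one_le_iff_zero_less)
    define t where "t = nat (\<bar>l\<bar> + 2 * int (P 0 0) + 1)"
    have t: "int t = \<bar>l\<bar> + 2 * int (P 0 0) + 1" by (simp add: t_def)
    have eq: "2 * int (P (t * u) (t * v)) = 2 * int (P 0 0) - c * D * int t ^ 2 + int t * l"
      using shift[of 0 t 0] by (simp add: D_def l_def algebra_simps)
    have "1 * int t ^ 2 \<le> c * D * int t ^ 2" using cD by (intro mult_right_mono) auto
    moreover have "int t ^ 2 = int t * \<bar>l\<bar> + 2 * int t * int (P 0 0) + int t"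
      by (simp add: t power2_eq_square algebra_simps)
    moreover have "int t * l \<le> int t * \<bar>l\<bar>" by (intro mult_left_mono) auto
    moreover have "2 * 1 * int (P 0 0) \<le> 2 * int t * int (P 0 0)"
      using t by (intro mult_right_mono) auto
    ultimately show False using eq t by linarith
  next
    case True
    define l' where "l' = int (P u v) - int (P 0 0)"
    have l: "l = 2 * l'" using shift[of 0 1 0] True by (simp add: l_def l'_def)
    have sh: "int (P (x + t * u) (t * v)) = int (P x 0) + int t * l'" for x t
      using shift[of x t 0] True l l_def by simp
    have "l' \<ge> 0"
    proof (rule ccontr)
      assume "\<not> l' \<ge> 0"
      then have "int (P 0 0 + 1) * l' \<le> int (P 0 0 + 1) * - 1"
        by (intro mult_left_mono) auto
      then have "int (P (0 + (P 0 0 + 1) * u) ((P 0 0 + 1) * v)) \<le> - 1"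
        unfolding sh by simp
      then show False by linarith
    qed
    moreover have "l' \<noteq> 0" using P_inj[of u v 0 0] v by (auto simp: l'_def)
    ultimately have l': "l' > 0" by simp
    have "\<not> inj_on (\<lambda>x. P x 0 mod nat l') {..nat l'}"
    proof (rule pigeonhole)
      have "(\<lambda>x. P x 0 mod nat l') ` {..nat l'} \<subseteq> {..<nat l'}" using l' by auto
      then have "card ((\<lambda>x. P x 0 mod nat l') ` {..nat l'}) \<le> card {..<nat l'}"
        by (intro card_mono) auto
      then show "card ((\<lambda>x. P x 0 mod nat l') ` {..nat l'}) < card {..nat l'}" by simp
    qed
    then obtain x x' where "x \<noteq> x'" "P x 0 mod nat l' = P x' 0 mod nat l'"
      unfolding inj_on_def by blast
    then obtain x x' where x: "x \<noteq> x'" "P x 0 mod nat l' = P x' 0 mod nat l'" "P x 0 \<le> P x' 0"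
      by (metis nat_le_linear)
    then have "nat l' dvd P x' 0 - P x 0" by (metis mod_eq_dvd_iff_nat)
    then obtain t where "P x' 0 - P x 0 = t * nat l'" by (metis dvd_def mult.commute)
    then have "int (P x' 0) = int (P x 0) + int t * l'"
      using x(3) l' by (metis add_diff_inverse_nat int_nat_eq leD less_le of_nat_add of_nat_mult)
    with sh[of x t] have "P x' 0 = P (x + t * u) (t * v)" by simp
    then have "x' = x + t * u" "t * v = 0" using P_inj by metis+
    with v x(1) show False by simp
  qed
qed

section \<open>Quadratic growth and bounded shifts\<close>

lemma coercive:
  obtains K :: nat where "\<And>n x y. n \<ge> 1 \<Longrightarrow> P x y \<le> n\<^sup>2 \<Longrightarrow> x + y \<le> K * n"
proof -
  interpret sw: quadratic_pairing "\<lambda>x y. P y x" c b a e d f by (rule swap)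
  have ac: "a \<ge> 1" "c \<ge> 1" by (rule leading_coeff_pos sw.leading_coeff_pos)+
  define k m where "k = 2 * a + 2 * c" and "m = \<bar>d\<bar> + \<bar>e\<bar> + 2 * \<bar>f\<bar>"
  have m: "m \<ge> 0" and k: "k \<ge> 1" using ac by (auto simp: m_def k_def)
  define q where "q x y = a * x\<^sup>2 + 2 * b * x * y + c * y\<^sup>2" for x y :: int
  \<comment> \<open>For \<open>b \<ge> 0\<close> the mixed term only helps. For \<open>b < 0\<close>
    completing the square leaves a multiple of \<open>y\<^sup>2\<close> or \<open>x\<^sup>2\<close>
    by the positive integer \<open>a * c - b\<^sup>2\<close>.\<close>
  have q: "(x + y)\<^sup>2 \<le> k * q x y" if "x \<ge> 0" "y \<ge> 0" for x y
  proof -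
    have "(x + y)\<^sup>2 + (x - y)\<^sup>2 = 2 * x\<^sup>2 + 2 * y\<^sup>2" by algebra
    then have 1: "(x + y)\<^sup>2 \<le> 2 * x\<^sup>2 + 2 * y\<^sup>2" by (smt (verit) zero_le_power2)
    have 2: "x\<^sup>2 \<le> c * q x y \<and> y\<^sup>2 \<le> a * q x y"
    proof (cases "b \<ge> 0")
      case True
      have "1 * x\<^sup>2 \<le> a * x\<^sup>2" "1 * y\<^sup>2 \<le> c * y\<^sup>2" using ac by (intro mult_right_mono; simp)+
      moreover have "2 * b * x * y \<ge> 0" using True that by simp
      ultimately have *: "x\<^sup>2 \<le> q x y" "y\<^sup>2 \<le> q x y" unfolding q_def
        by (smt (verit) zero_le_power2)+
      have "q x y \<ge> 0" using * by (smt (verit) zero_le_power2)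
      then have "1 * q x y \<le> a * q x y" "1 * q x y \<le> c * q x y"
        using ac by (intro mult_right_mono; simp)+
      then show ?thesis using * by simp
    next
      case False
      then have D: "a * c - b\<^sup>2 \<ge> 1" using discriminant_of_neg by simp
      have "a * q x y = (a * x + b * y)\<^sup>2 + (a * c - b\<^sup>2) * y\<^sup>2"
        "c * q x y = (c * y + b * x)\<^sup>2 + (a * c - b\<^sup>2) * x\<^sup>2"
        unfolding q_def by algebra+
      moreover have "1 * x\<^sup>2 \<le> (a * c - b\<^sup>2) * x\<^sup>2" "1 * y\<^sup>2 \<le> (a * c - b\<^sup>2) * y\<^sup>2"
        using D by (intro mult_right_mono; simp)+
      ultimately show ?thesis by (smt (verit) zero_le_power2)
    qed
    have "k * q x y = 2 * (c * q x y) + 2 * (a * q x y)" by (simp add: k_def algebra_simps)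
    with 1 2 show ?thesis by linarith
  qed
  \<comment> \<open>If \<open>s = x + y\<close> exceeds \<open>K * n\<close>, the form is at most
    \<open>2 * n\<^sup>2 + m * s\<close>, hence at most \<open>(2 + 2 * m) * n * s\<close>.
    Multiplying by \<open>k\<close> gives \<open>K * n * s\<close>, which is less than
    \<open>s\<^sup>2\<close>, contrary to \<open>q\<close>.\<close>
  define K where "K = k * (2 + 2 * m)"
  have "x + y \<le> nat K * n" if n: "n \<ge> 1" and P: "P x y \<le> n\<^sup>2" for n x y
  proof (rule ccontr)
    define s where "s = int x + int y"
    have K: "K \<ge> 2" using k m mult_mono[of 1 k 2 "2 + 2 * m"] by (simp add: K_def)
    assume "\<not> x + y \<le> nat K * n"
    then have "int (nat K * n) < int (x + y)" by linarith
    then have s: "s > K * int n" using K by (simp add: s_def)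
    have "K * int n \<ge> 1 * int n" using K by (intro mult_right_mono) auto
    then have sn: "s \<ge> int n" "s \<ge> 1" using s n by linarith+
    have P': "2 * int (P x y) \<le> 2 * (int n)\<^sup>2" using P by (simp flip: of_nat_power)
    have "- (\<bar>d\<bar> * s) \<le> d * int x" "- (\<bar>e\<bar> * s) \<le> e * int y"
    proof -
      have "\<bar>z * w\<bar> \<le> \<bar>z\<bar> * s" if "0 \<le> w" "w \<le> s" for z w
        unfolding abs_mult using that by (intro mult_left_mono) auto
      from this[of "int x" d] this[of "int y" e]
      show "- (\<bar>d\<bar> * s) \<le> d * int x" "- (\<bar>e\<bar> * s) \<le> e * int y"
        by (auto simp: s_def)
    qed
    moreover have "- (2 * \<bar>f\<bar> * s) \<le> 2 * f"
    proof -
      have "2 * \<bar>f\<bar> * 1 \<le> 2 * \<bar>f\<bar> * s" using sn by (intro mult_left_mono) auto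
      then show ?thesis by linarith
    qed
    moreover have "m * s = \<bar>d\<bar> * s + \<bar>e\<bar> * s + 2 * \<bar>f\<bar> * s" by (simp add: m_def algebra_simps)
    ultimately have "q (int x) (int y) \<le> 2 * (int n)\<^sup>2 + m * s"
      using P' P_eq[of x y] unfolding q_def by linarith
    also have "2 * (int n)\<^sup>2 \<le> 2 * int n * s" using sn by (simp add: power2_eq_square mult_left_mono)
    also have "m * s \<le> 2 * m * int n * s"
    proof -
      have "m * s * 1 \<le> m * s * (2 * int n)" using m sn n by (intro mult_left_mono) auto
      then show ?thesis by (simp add: algebra_simps)
    qed
    finally have "k * q (int x) (int y) \<le> k * (2 * int n * s + 2 * m * int n * s)"
      using k by (intro mult_left_mono) auto
    also have "\<dots> = s * (K * int n)" by (simp add: K_def algebra_simps)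
    also have "\<dots> < s * s" using s sn by (intro mult_strict_left_mono) auto
    finally show False using q[of "int x" "int y"] by (simp add: s_def power2_eq_square)
  qed
  then show thesis using that by blast
qed

text \<open>Each term of the difference of two values is a coordinate shift, bounded by
  \<open>M\<close>, times a factor at most linear in the coordinates, and these are O(n) by
  \<open>coercive\<close>.\<close>

lemma shift_bound:
  fixes M :: nat
  obtains L :: nat where "\<And>n x y x' y'. n \<ge> 1 \<Longrightarrow> P x y < n\<^sup>2 \<Longrightarrow> \<bar>int x' - int x\<bar> \<le> int M
    \<Longrightarrow> \<bar>int y' - int y\<bar> \<le> int M \<Longrightarrow> P x' y' < n\<^sup>2 + L * n"
proof -
  obtain K :: nat where K: "\<And>n x y. n \<ge> 1 \<Longrightarrow> P x y \<le> n\<^sup>2 \<Longrightarrow> x + y \<le> K * n" 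
    using coercive by blast
  define m where "m = \<bar>a\<bar> + 2 * \<bar>b\<bar> + \<bar>c\<bar> + \<bar>d\<bar> + \<bar>e\<bar>"
  define L where "L = m * (int M * (2 * int K + int M + 1))"
  have L0: "L \<ge> 0" by (simp add: L_def m_def)
  have "P x' y' < n\<^sup>2 + nat L * n"
    if n: "n \<ge> 1" and P: "P x y < n\<^sup>2" and x': "\<bar>int x' - int x\<bar> \<le> int M"
      and y': "\<bar>int y' - int y\<bar> \<le> int M" for n x y x' y'
  proof -
    define h k where "h = int x' - int x" and "k = int y' - int y"
    define W where "W = int M * ((2 * int K + int M + 1) * int n)"
    have hk: "\<bar>h\<bar> \<le> int M" "\<bar>k\<bar> \<le> int M" using x' y' by (auto simp: h_def k_def)
    have "x + y \<le> K * n" using K n P by simp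
    then have "int x + int y \<le> int K * int n" by (metis of_nat_add of_nat_le_iff of_nat_mult)
    moreover have "(int M + 1) * 1 \<le> (int M + 1) * int n" using n by (intro mult_left_mono) auto
    ultimately have B: "2 * int x + 2 * int y + int M + 1 \<le> (2 * int K + int M + 1) * int n"
      by (simp add: algebra_simps)
    have bd: "\<bar>u * v\<bar> \<le> W" if "\<bar>u\<bar> \<le> int M" "\<bar>v\<bar> \<le> 2 * int x + 2 * int y + int M + 1" for u v
      unfolding W_def abs_mult using that B by (intro mult_mono) auto
    have bd': "z * w \<le> \<bar>z\<bar> * W" if "\<bar>w\<bar> \<le> W" for z w
    proof -
      have "z * w \<le> \<bar>z * w\<bar>" by (rule abs_ge_self)
      also have "\<dots> \<le> \<bar>z\<bar> * W" unfolding abs_mult using that by (intro mult_left_mono) auto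
      finally show ?thesis .
    qed
    have hk_eq: "int x' = int x + h" "int y' = int y + k" by (auto simp: h_def k_def)
    have "2 * int (P x' y') - 2 * int (P x y) = a * (h * (2 * int x + h))
      + 2 * b * (h * int y + k * (int x + h)) + c * (k * (2 * int y + k)) + d * (h * 1) + e * (k * 1)"
      unfolding P_eq hk_eq by (simp add: power2_eq_square algebra_simps)
    also have "\<dots> \<le> \<bar>a\<bar> * W + \<bar>2 * b\<bar> * (2 * W) + \<bar>c\<bar> * W + \<bar>d\<bar> * W + \<bar>e\<bar> * W"
    proof (intro add_mono)
      have "\<bar>h * int y + k * (int x + h)\<bar> \<le> 2 * W"
        using bd[of h "int y"] bd[of k "int x + h"] hk by linarith
      then have "\<bar>2 * b\<bar> * \<bar>h * int y + k * (int x + h)\<bar> \<le> \<bar>2 * b\<bar> * (2 * W)"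
        by (intro mult_left_mono) auto
      then show "2 * b * (h * int y + k * (int x + h)) \<le> \<bar>2 * b\<bar> * (2 * W)"
        using abs_ge_self[of "2 * b * (h * int y + k * (int x + h))"]
        unfolding abs_mult[of "2 * b"] by linarith
    qed (intro bd' bd; use hk in linarith)+
    also have "\<dots> \<le> 2 * (m * W)"
    proof -
      have "W \<ge> 0" by (simp add: W_def)
      then have "\<bar>a\<bar> * W \<ge> 0" "\<bar>c\<bar> * W \<ge> 0" "\<bar>d\<bar> * W \<ge> 0" "\<bar>e\<bar> * W \<ge> 0" by auto
      then show ?thesis by (simp add: m_def abs_mult algebra_simps)
    qed
    also have "m * W = L * int n" by (simp add: L_def W_def algebra_simps)
    finally have "int (P x' y') \<le> int (P x y) + L * int n" by linarith
    also have "\<dots> = int (P x y + nat L * n)" using L0 by simp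
    finally show ?thesis using P by linarith
  qed
  then show thesis using that by blast
qed

section \<open>Equidistribution among residue classes\<close>

lemma bij_below: "bij_betw (\<lambda>(x, y). P x y) {(x, y). P x y < N \<and> Q (P x y)} {v. v < N \<and> Q v}"
  unfolding bij_betw_def
proof
  show "inj_on (\<lambda>(x, y). P x y) {(x, y). P x y < N \<and> Q (P x y)}"
    by (auto simp: inj_on_def dest: P_inj)
  show "(\<lambda>(x, y). P x y) ` {(x, y). P x y < N \<and> Q (P x y)} = {v. v < N \<and> Q v}"
    proof safe
    fix v assume "v < N" "Q v"
    moreover obtain x y where "P x y = v" using P_surj by blast
    ultimately show "v \<in> (\<lambda>(x, y). P x y) ` {(x, y). P x y < N \<and> Q (P x y)}"
      by (intro image_eqI[of _ _ "(x, y)"]) auto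
  qed
qed

lemma finite_below: "finite {(x, y). P x y < N \<and> Q (P x y)}"
  using bij_betw_finite[OF bij_below[of N Q]] by simp

lemma finite_below': "finite {(x, y). P x y < N \<and> Q x y}"
  by (rule finite_subset[OF _ finite_below[of N "\<lambda>_. True"]]) auto

definition residue_count :: "nat \<Rightarrow> nat \<Rightarrow> nat \<times> nat \<Rightarrow> nat" where
  "residue_count M N r = card {(x, y). P x y < N \<and> x mod M = fst r \<and> y mod M = snd r}"

text \<open>Each of the \<open>E\<close> additional values has just one preimage.\<close>

lemma residue_count_add: "residue_count M (N + E) r \<le> residue_count M N r + E"
proof -
  let ?A = "\<lambda>N. {(x, y). P x y < N \<and> x mod M = fst r \<and> y mod M = snd r}"
  let ?B = "{(x, y). P x y < N + E \<and> N \<le> P x y}"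
  have "card (?A (N + E)) \<le> card (?A N \<union> ?B)"
    by (intro card_mono finite_UnI finite_below') auto
  also have "\<dots> \<le> card (?A N) + card ?B" by (rule card_Un_le)
  also have "card ?B = card {v. v < N + E \<and> N \<le> v}" by (rule bij_betw_same_card[OF bij_below])
  also have "{v. v < N + E \<and> N \<le> v} = {N..<N+E}" by auto
  finally show ?thesis by (simp add: residue_count_def)
qed

text \<open>Moving a point inside its \<open>M\<close> by \<open>M\<close> cell from residues
  \<open>r\<close> to residues \<open>r'\<close> is injective on the class and raises the value
  bound by only O(n).\<close>

lemma residue_count_le:
  assumes M: "M > 0"
  obtains L where "\<And>n r r'. n \<ge> 1 \<Longrightarrow> r \<in> {..<M} \<times> {..<M} \<Longrightarrow> r' \<in> {..<M} \<times> {..<M}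
    \<Longrightarrow> residue_count M (n\<^sup>2) r \<le> residue_count M (n\<^sup>2) r' + L * n"
proof -
  obtain L :: nat where L: "\<And>n x y x' y'. n \<ge> 1 \<Longrightarrow> P x y < n\<^sup>2 \<Longrightarrow> \<bar>int x' - int x\<bar> \<le> int M
    \<Longrightarrow> \<bar>int y' - int y\<bar> \<le> int M \<Longrightarrow> P x' y' < n\<^sup>2 + L * n"
    using shift_bound by blast
  have "residue_count M (n\<^sup>2) r \<le> residue_count M (n\<^sup>2) r' + L * n"
    if n: "n \<ge> 1" and r: "r \<in> {..<M} \<times> {..<M}" and r': "r' \<in> {..<M} \<times> {..<M}" for n r r'
  proof -
    obtain i j k l where [simp]: "r = (i, j)" "r' = (k, l)" by (metis surj_pair)
    have lt: "i < M" "j < M" "k < M" "l < M" using r r' by auto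
    let ?A = "\<lambda>N r. {(x, y). P x y < N \<and> x mod M = fst r \<and> y mod M = snd r}"
    let ?g = "\<lambda>(x, y). (x div M * M + k, y div M * M + l)"
    have "residue_count M (n\<^sup>2) r \<le> residue_count M (n\<^sup>2 + L * n) r'"
      unfolding residue_count_def
    proof (rule card_inj_on_le)
      show "inj_on ?g (?A (n\<^sup>2) r)"
        using M by (auto simp: inj_on_def) (metis div_mult_mod_eq)+
      have near: "\<bar>int (x div M * M + k') - int x\<bar> \<le> int M" if "k' < M" for x k'
      proof -
        have "x = x div M * M + x mod M" by simp
        then have "int x = int (x div M * M) + int (x mod M)" by (metis of_nat_add)
        moreover have "x mod M < M" using M by simp
        ultimately show ?thesis using that by linarith
      qed
      show "?g ` ?A (n\<^sup>2) r \<subseteq> ?A (n\<^sup>2 + L * n) r'"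
        using lt by (auto intro!: L[OF n] near)
    qed (rule finite_below')
    also have "\<dots> \<le> residue_count M (n\<^sup>2) r' + L * n" by (rule residue_count_add)
    finally show ?thesis .
  qed
  then show thesis using that by blast
qed

lemma sum_residue_count:
  assumes "M > 0" "R \<subseteq> {..<M} \<times> {..<M}"
  shows "(\<Sum>r\<in>R. residue_count M N r) = card {(x, y). P x y < N \<and> (x mod M, y mod M) \<in> R}"
proof -
  let ?S = "{(x, y). P x y < N \<and> (x mod M, y mod M) \<in> R}"
  let ?g = "\<lambda>(x, y). (x mod M, y mod M)"
  have fR: "finite R" using assms finite_subset by blast
  have "card ?S = (\<Sum>z\<in>?S. 1)" by simp
  also have "\<dots> = (\<Sum>r\<in>R. \<Sum>z\<in>{z\<in>?S. ?g z = r}. 1)"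
    by (rule sum.group[symmetric]) (auto simp: fR finite_below')
  also have "\<dots> = (\<Sum>r\<in>R. residue_count M N r)"
  proof (rule sum.cong[OF refl])
    fix r assume "r \<in> R"
    then have "{z\<in>?S. ?g z = r} = {(x, y). P x y < N \<and> x mod M = fst r \<and> y mod M = snd r}"
      by auto
    then show "(\<Sum>z\<in>{z\<in>?S. ?g z = r}. 1) = residue_count M N r"
      by (simp add: residue_count_def)
  qed
  finally show ?thesis by simp
qed

text \<open>Oddness of \<open>M\<close> allows the factor 2 to be cancelled. The integer
  representatives may be negative or large, as the critical point and the lines through it are given
  by integer formulas.\<close>

lemma P_cong:
  assumes "odd M" "int M dvd (a * X\<^sup>2 + 2 * b * X * Y + c * Y\<^sup>2 + d * X + e * Y)
     - (a * X'\<^sup>2 + 2 * b * X' * Y' + c * Y'\<^sup>2 + d * X' + e * Y')"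
    "int M dvd int x - X" "int M dvd int y - Y" "int M dvd int x' - X'" "int M dvd int y' - Y'"
  shows "P x y mod M = P x' y' mod M"
proof -
  have *: "int M dvd 2 * int (P x y) - (a * X\<^sup>2 + 2 * b * X * Y + c * Y\<^sup>2 + d * X + e * Y + 2 * f)"
    if x: "int M dvd int x - X" and y: "int M dvd int y - Y" for x y X Y
  proof -
    have "2 * int (P x y) - (a * X\<^sup>2 + 2 * b * X * Y + c * Y\<^sup>2 + d * X + e * Y + 2 * f)
      = (int x - X) * (a * (int x + X) + 2 * b * int y + d)
        + (int y - Y) * (2 * b * X + c * (int y + Y) + e)"
      unfolding P_eq by algebra
    then show ?thesis using x y by simp
  qed
  have "int M dvd (2 * int (P x y) - (a * X\<^sup>2 + 2 * b * X * Y + c * Y\<^sup>2 + d * X + e * Y + 2 * f))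
    - (2 * int (P x' y') - (a * X'\<^sup>2 + 2 * b * X' * Y' + c * Y'\<^sup>2 + d * X' + e * Y' + 2 * f))
    + ((a * X\<^sup>2 + 2 * b * X * Y + c * Y\<^sup>2 + d * X + e * Y)
     - (a * X'\<^sup>2 + 2 * b * X' * Y' + c * Y'\<^sup>2 + d * X' + e * Y'))"
    by (rule dvd_add[OF dvd_diff[OF *[OF assms(3,4)] *[OF assms(5,6)]] assms(2)])
  then have "int M dvd 2 * (int (P x y) - int (P x' y'))" by (simp add: algebra_simps)
  moreover have "coprime (int M) 2" using assms(1) by simp
  ultimately have "int M dvd int (P x y) - int (P x' y')"
    using coprime_dvd_mult_right_iff by blast
  then show ?thesis by (metis mod_eq_dvd_iff of_nat_eq_iff zmod_int)
qed

text \<open>Each of the \<open>M\<^sup>2\<close> classes holds about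
  \<open>n\<^sup>2 / M\<^sup>2\<close> of the points below \<open>n\<^sup>2\<close>, whereas only
  about \<open>n\<^sup>2 / M\<close> values are congruent to \<open>r\<close>. This leaves room for
  at most \<open>M\<close> classes.\<close>

lemma card_residues_le:
  assumes M: "odd M" and r: "r < M"
  shows "card {(i, j). i < M \<and> j < M \<and> P i j mod M = r} \<le> M"
proof (rule ccontr)
  define R where "R = {(i, j). i < M \<and> j < M \<and> P i j mod M = r}"
  assume "\<not> card {(i, j). i < M \<and> j < M \<and> P i j mod M = r} \<le> M"
  then have R: "card R \<ge> M + 1" by (simp add: R_def)
  have M0: "M > 0" using r by simp
  have RM: "R \<subseteq> {..<M} \<times> {..<M}" by (auto simp: R_def)
  obtain L where L: "\<And>n r r'. n \<ge> 1 \<Longrightarrow> r \<in> {..<M} \<times> {..<M} \<Longrightarrow> r' \<in> {..<M} \<times> {..<M}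
    \<Longrightarrow> residue_count M (n\<^sup>2) r \<le> residue_count M (n\<^sup>2) r' + L * n"
    using residue_count_le[OF M0] by blast
  \<comment> \<open>As \<open>n\<close> is a multiple of \<open>M\<close>, exactly
    \<open>M * k\<^sup>2\<close> values below \<open>n\<^sup>2\<close> have a given residue. The
    total error \<open>card R * M * M * L * n\<close> equals \<open>(k - 1) * n\<close>, which stays
    below \<open>n * n\<close>.\<close>
  define k n where "k = card R * M * M * L + 1" and "n = M * k"
  have n: "n \<ge> 1" using M0 by (simp add: n_def k_def)
  have all: "(\<Sum>s\<in>{..<M} \<times> {..<M}. residue_count M (n\<^sup>2) s) = n\<^sup>2"
  proof -
    have "{(x, y). P x y < n\<^sup>2 \<and> (x mod M, y mod M) \<in> {..<M} \<times> {..<M}}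
       = {(x, y). P x y < n\<^sup>2 \<and> True}" using M0 by auto
    then show ?thesis
      using sum_residue_count[OF M0 order_refl, of "n\<^sup>2"]
        bij_betw_same_card[OF bij_below[of "n\<^sup>2" "\<lambda>_. True"]] by simp
  qed
  have "P x y mod M = P (x mod M) (y mod M) mod M" for x y
    by (rule P_cong[OF M, where X = "int x" and Y = "int y" and X' = "int x" and Y' = "int y"])
      (auto simp: zmod_int mod_eq_dvd_iff[symmetric])
  then have "{(x, y). P x y < n\<^sup>2 \<and> (x mod M, y mod M) \<in> R}
      = {(x, y). P x y < n\<^sup>2 \<and> P x y mod M = r}"
    using M0 by (auto simp: R_def)
  then have "(\<Sum>s\<in>R. residue_count M (n\<^sup>2) s) = card {v. v < n\<^sup>2 \<and> v mod M = r}"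
    using sum_residue_count[OF M0 RM, of "n\<^sup>2"]
      bij_betw_same_card[OF bij_below[of "n\<^sup>2" "\<lambda>v. v mod M = r"]] by simp
  also have "\<dots> \<le> card ((\<lambda>t. M * t + r) ` {..<M * k\<^sup>2})"
  proof (rule card_mono)
    show "{v. v < n\<^sup>2 \<and> v mod M = r} \<subseteq> (\<lambda>t. M * t + r) ` {..<M * k\<^sup>2}"
    proof clarify
      fix v assume v: "v < n\<^sup>2" and r: "r = v mod M"
      have "v < M * k\<^sup>2 * M" using v by (simp add: n_def power2_eq_square algebra_simps)
      then have "v div M < M * k\<^sup>2" using less_mult_imp_div_less by blast
      then show "v \<in> (\<lambda>t. M * t + v mod M) ` {..<M * k\<^sup>2}" by (intro image_eqI[of _ _ "v div M"]) auto
    qed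
  qed simp
  also have "\<dots> \<le> M * k\<^sup>2" using card_image_le[of "{..<M * k\<^sup>2}" "\<lambda>t. M * t + r"] by simp
  finally have part: "(\<Sum>s\<in>R. residue_count M (n\<^sup>2) s) \<le> M * k\<^sup>2" .
  \<comment> \<open>Double counting: all classes together are compared with each class of
    \<open>R\<close> in turn.\<close>
  have "card R * n\<^sup>2 = (\<Sum>s\<in>R. \<Sum>t\<in>{..<M} \<times> {..<M}. residue_count M (n\<^sup>2) t)"
    using all by simp
  also have "\<dots> \<le> (\<Sum>s\<in>R. \<Sum>t\<in>{..<M} \<times> {..<M}. residue_count M (n\<^sup>2) s + L * n)"
    using RM by (intro sum_mono L n) auto
  also have "\<dots> = M * M * (\<Sum>s\<in>R. residue_count M (n\<^sup>2) s) + card R * (M * M * (L * n))"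
    by (simp add: sum.distrib sum_distrib_left algebra_simps)
  also have "\<dots> \<le> M * M * (M * k\<^sup>2) + card R * (M * M * (L * n))"
    using part by simp
  also have "\<dots> = M * n\<^sup>2 + (k - 1) * n" by (simp add: n_def k_def power2_eq_square algebra_simps)
  finally have "card R * n\<^sup>2 \<le> M * n\<^sup>2 + (k - 1) * n" .
  moreover have "(M + 1) * n\<^sup>2 \<le> card R * n\<^sup>2" using R by (intro mult_right_mono) auto
  moreover have "(M + 1) * n\<^sup>2 = M * n\<^sup>2 + n * n" by (simp add: power2_eq_square)
  ultimately have "n * n \<le> (k - 1) * n" by linarith
  then have "n \<le> k - 1" using n by simp
  moreover have "k \<le> n" using M0 by (simp add: n_def)
  ultimately show False by (simp add: k_def)
qed

section \<open>Vanishing of the discriminant\<close>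

lemma discriminant_zero: "b\<^sup>2 = a * c"
proof (rule ccontr)
  assume "b\<^sup>2 \<noteq> a * c"
  define D where "D = a * c - b\<^sup>2"
  have D0: "D \<noteq> 0" using \<open>b\<^sup>2 \<noteq> a * c\<close> by (simp add: D_def)
  have a: "a \<ge> 1" by (rule leading_coeff_pos)
  define m where "m = 4 * D * a\<^sup>2 + 1"
  define M where "M = nat \<bar>m\<bar>"
  have "D * a\<^sup>2 \<noteq> 0" using D0 a by simp
  then have M3: "M \<ge> 3" unfolding M_def m_def by linarith
  have "odd m" by (simp add: m_def)
  then have oddM: "odd M" by (simp add: M_def even_nat_iff)
  have Mdvd: "int M dvd z \<longleftrightarrow> m dvd z" for z by (simp add: M_def)
  \<comment> \<open>Modulo \<open>m\<close> we have \<open>4 D a\<^sup>2 = -1\<close>, so \<open>2 D\<close> and \<open>a\<close> are units and \<open>- D = (2 D a)\<^sup>2\<close> is a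
    square. Hence \<open>P\<close> has a critical point \<open>(X, Y)\<close>, and two distinct lines through it, of
    directions \<open>(\<alpha>, 1)\<close> and \<open>(\<beta>, 1)\<close>, on which the quadratic form vanishes.\<close>
  define X Y where "X = - 2 * a\<^sup>2 * (b * e - c * d)" and "Y = - 2 * a\<^sup>2 * (b * d - a * e)"
  define \<alpha> \<beta> where "\<alpha> = - 4 * D * a * (2 * D * a - b)" and "\<beta> = - 4 * D * a * (- 2 * D * a - b)"
  define F where "F x y = a * x\<^sup>2 + 2 * b * x * y + c * y\<^sup>2 + d * x + e * y" for x y
  \<comment> \<open>Modulo \<open>m\<close> the inverse of \<open>a\<close> is
    \<open>- 4 * D * a\<close>, and \<open>s\<close> is a square root of \<open>- D\<close>, so
    \<open>\<gamma>\<close> is the quadratic formula \<open>(s - b) / a\<close>.\<close>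
  have root: "m dvd a * \<gamma>\<^sup>2 + 2 * b * \<gamma> + c"
    if "\<gamma> = - 4 * D * a * (s - b)" "s\<^sup>2 = 4 * D\<^sup>2 * a\<^sup>2" for \<gamma> s
  proof -
    have "a * \<gamma> + b = s - m * (s - b)" unfolding that(1) m_def by algebra
    then have "a * (a * \<gamma>\<^sup>2 + 2 * b * \<gamma> + c) = (s - m * (s - b))\<^sup>2 + D"
      unfolding D_def by algebra
    also have "\<dots> = m * (D - 2 * s * (s - b) + m * (s - b)\<^sup>2)"
      using that(2) unfolding m_def by algebra
    finally have "m dvd 4 * D * a * (a * (a * \<gamma>\<^sup>2 + 2 * b * \<gamma> + c))" by simp
    then have "m dvd m * (a * \<gamma>\<^sup>2 + 2 * b * \<gamma> + c) - 4 * D * a * (a * (a * \<gamma>\<^sup>2 + 2 * b * \<gamma> + c))"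
      by (intro dvd_diff) auto
    also have "m * (a * \<gamma>\<^sup>2 + 2 * b * \<gamma> + c) - 4 * D * a * (a * (a * \<gamma>\<^sup>2 + 2 * b * \<gamma> + c))
      = a * \<gamma>\<^sup>2 + 2 * b * \<gamma> + c" unfolding m_def by algebra
    finally show ?thesis .
  qed
  \<comment> \<open>Cramer's rule for the vanishing gradient, with \<open>- 2 * a\<^sup>2\<close> as
    the inverse of \<open>2 * D\<close> modulo \<open>m\<close>.\<close>
  have crit: "2 * a * X + 2 * b * Y + d = d * m" "2 * b * X + 2 * c * Y + e = e * m"
    unfolding X_def Y_def m_def D_def by algebra+
  have isotropic: "m dvd F (X + \<gamma> * v) (Y + v) - F X Y" if "m dvd a * \<gamma>\<^sup>2 + 2 * b * \<gamma> + c" for \<gamma> v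
  proof -
    have "F (X + \<gamma> * v) (Y + v) - F X Y = \<gamma> * v * (2 * a * X + 2 * b * Y + d)
      + v * (2 * b * X + 2 * c * Y + e) + v\<^sup>2 * (a * \<gamma>\<^sup>2 + 2 * b * \<gamma> + c)"
      unfolding F_def by algebra
    then show ?thesis unfolding crit using that by simp
  qed
  define r where "r = P (nat (X mod int M)) (nat (Y mod int M)) mod M"
  define h where "h \<gamma> v = (nat ((X + \<gamma> * v) mod int M), nat ((Y + v) mod int M))" for \<gamma> v
  let ?R = "{(i, j). i < M \<and> j < M \<and> P i j mod M = r}"
  have res: "int M dvd int (nat (z mod int M)) - z" "nat (z mod int M) < M" for z
    using M3 by (auto simp: nat_less_iff simp flip: mod_eq_dvd_iff)
  have hR: "h \<gamma> v \<in> ?R" if "m dvd a * \<gamma>\<^sup>2 + 2 * b * \<gamma> + c" for \<gamma> v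
    using isotropic[OF that, of v] unfolding h_def r_def F_def
    by (auto simp: res simp flip: Mdvd simp del: int_nat_eq
        intro!: P_cong[OF oddM, of "X + \<gamma> * v" "Y + v" X Y])
  have \<alpha>: "m dvd a * \<alpha>\<^sup>2 + 2 * b * \<alpha> + c"
    by (rule root[of _ "2 * D * a"]) (simp_all add: \<alpha>_def power2_eq_square)
  have \<beta>: "m dvd a * \<beta>\<^sup>2 + 2 * b * \<beta> + c"
    by (rule root[of _ "- 2 * D * a"]) (simp_all add: \<beta>_def power2_eq_square)
  have h_eq: "m dvd v - w \<and> m dvd \<gamma> * v - \<delta> * w" if "h \<gamma> v = h \<delta> w" for \<gamma> \<delta> v w
  proof -
    have "(X + \<gamma> * v) mod int M = (X + \<delta> * w) mod int M" "(Y + v) mod int M = (Y + w) mod int M"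
      using that M3 by (simp_all add: h_def eq_nat_nat_iff)
    then show ?thesis unfolding mod_eq_dvd_iff Mdvd by simp
  qed
  have small: "v = w" if "m dvd v - w" "v \<in> {0..<int M}" "w \<in> {0..<int M}" for v w
  proof -
    have "int M dvd v - w" using that(1) by (simp add: Mdvd)
    then have "v mod int M = w mod int M" by (simp only: mod_eq_dvd_iff)
    with that(2,3) show ?thesis by simp
  qed
  \<comment> \<open>The first line supplies \<open>M\<close> classes with the same value modulo
    \<open>M\<close>; one point of the second line, off the critical point, supplies one too
    many.\<close>
  have "inj_on (h \<alpha>) {0..<int M}" using h_eq small by (meson inj_onI)
  then have "card (h \<alpha> ` {0..<int M}) = M" by (simp add: card_image)
  moreover have "h \<beta> 1 \<notin> h \<alpha> ` {0..<int M}"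
  proof
    assume "h \<beta> 1 \<in> h \<alpha> ` {0..<int M}"
    then obtain v where v: "h \<beta> 1 = h \<alpha> v" "v \<in> {0..<int M}" by blast
    with h_eq[OF v(1)] small[of 1 v] M3 have "m dvd \<beta> - \<alpha>" by auto
    \<comment> \<open>The product \<open>a\<^sup>2 * (\<beta> - \<alpha>)\<close> is
      \<open>(m - 1)\<^sup>2\<close>, hence 1 modulo \<open>m\<close>: the two directions
      differ.\<close>
    then have "m dvd a\<^sup>2 * (\<beta> - \<alpha>) - m * (m - 2)" by (intro dvd_diff) auto
    also have "a\<^sup>2 * (\<beta> - \<alpha>) - m * (m - 2) = 1"
      unfolding \<alpha>_def \<beta>_def m_def by algebra
    finally show False using M3 by (simp add: M_def)
  qed
  ultimately have "M + 1 = card (insert (h \<beta> 1) (h \<alpha> ` {0..<int M}))" by simp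
  also have "\<dots> \<le> card ?R"
  proof (rule card_mono)
    show "finite ?R" by (rule finite_subset[of _ "{..<M} \<times> {..<M}"]) auto
    show "insert (h \<beta> 1) (h \<alpha> ` {0..<int M}) \<subseteq> ?R"
      by (intro insert_subset[THEN iffD2] conjI image_subsetI hR \<alpha> \<beta>)
  qed
  also have "\<dots> \<le> M" using M3 by (intro card_residues_le[OF oddM]) (auto simp: r_def)
  finally show False by simp
qed

section \<open>Determination of the coefficients\<close>

lemma quadratic_coeffs: "a = 1" "b = 1" "c = 1"
proof -
  interpret sw: quadratic_pairing "\<lambda>x y. P y x" c b a e d f by (rule swap)
  have ac: "a \<ge> 1" "c \<ge> 1" by (rule leading_coeff_pos sw.leading_coeff_pos)+
  have "b\<^sup>2 \<ge> 1" using ac mult_mono[of 1 a 1 c] by (simp add: discriminant_zero)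
  then have b: "b \<ge> 1" using discriminant_of_neg discriminant_zero by (cases "b = 0") force+
  \<comment> \<open>Now \<open>a\<close> times the form is \<open>(a * x + b * y)\<^sup>2\<close>.
    Up to lower order, \<open>P < N\<close> cuts out the triangle \<open>a * x + b * y < t\<close>
    with \<open>N = t\<^sup>2 / (2 * a)\<close>. Its area \<open>t\<^sup>2 / (2 * a * b)\<close> can
    match the \<open>N\<close> points in it only if \<open>b \<le> 1\<close>.\<close>
  have "b \<le> 1"
  proof (rule ccontr)
    assume "\<not> b \<le> 1"
    then have b2: "b \<ge> 2" by simp
    \<comment> \<open>The counts will give \<open>2 * (b * j - m) \<le> 2 * j + 1\<close>. With
      \<open>b \<ge> 2\<close> and \<open>j = m + 1\<close> the left side is at least
      \<open>2 * j + 2\<close>.\<close>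
    define m j where "m = \<bar>d\<bar> + \<bar>e\<bar> + 2 * \<bar>f\<bar>" and "j = nat m + 1"
    have j: "int j = m + 1" and m: "m \<ge> 0" by (auto simp: j_def m_def)
    define A B where "A = nat a" and "B = nat b"
    have AB: "int A = a" "int B = b" using ac b by (auto simp: A_def B_def)
    then have AB0: "A > 0" "B > 0" using ac b by linarith+
    \<comment> \<open>For \<open>t \<ge> 2 * a * b * j\<close> the lower bound
      \<open>t * (t - a * m)\<close> for \<open>2 * a * P\<close> is at least
      \<open>2 * a * N\<close>.\<close>
    define N where "N = A * B * j * 2 * nat (b * int j - m)"
    have bj: "b * int j \<ge> 2 * int j" using b2 by (intro mult_right_mono) auto
    have N: "int N = a * b * int j * 2 * (b * int j - m)" using bj j m AB by (simp add: N_def)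
    \<comment> \<open>Cells of size \<open>B\<close> by \<open>A\<close> tile the quadrant, and
      \<open>a * x + b * y\<close> is at least \<open>a * b\<close> times the sum of the cell
      indices. Points with \<open>P < N\<close> therefore lie in a triangle of
      \<open>j * (2 * j + 1)\<close> cells.\<close>
    let ?T = "SIGMA u:{..<2 * j}. {..<2 * j - u}"
    let ?g = "\<lambda>(x, y). ((x div B, y div A), x mod B, y mod A)"
    have "N = card {(x, y). P x y < N \<and> True}"
      using bij_betw_same_card[OF bij_below[of N "\<lambda>_. True"]] by simp
    also have "\<dots> \<le> card (?T \<times> {..<B} \<times> {..<A})"
    proof (rule card_inj_on_le[where f = ?g])
      show "inj_on ?g {(x, y). P x y < N \<and> True}"
        by (auto simp: inj_on_def) (metis div_mult_mod_eq)+
      have "x div B + y div A < 2 * j" if P: "P x y < N" for x y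
      proof (rule ccontr)
        assume "\<not> x div B + y div A < 2 * j"
        then have "A * B * (2 * j) \<le> A * B * (x div B + y div A)" by (intro mult_left_mono) auto
        also have "\<dots> = A * (x div B * B) + B * (y div A * A)" by (simp add: algebra_simps)
        also have "\<dots> \<le> A * x + B * y" by (intro add_mono mult_left_mono div_times_less_eq_dividend) auto
        finally have "int (A * B * (2 * j)) \<le> int (A * x + B * y)" by linarith
        then have t: "a * b * (2 * int j) \<le> a * int x + b * int y" by (simp add: AB)
        define t where "t = a * int x + b * int y"
        have ab: "1 \<le> a * b" using ac b mult_mono[of 1 a 1 b] by simp
        have "1 * (2 * int j) \<le> a * b * (2 * int j)" using ab by (intro mult_right_mono) auto
        then have t1: "t \<ge> 1" using t j m unfolding t_def by linarith
        have xy: "int x \<le> t" "int y \<le> t"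
          using ac b mult_right_mono[of 1 a "int x"] mult_right_mono[of 1 b "int y"]
          by (auto simp: t_def add_increasing add_increasing2)
        have bd: "- (\<bar>z\<bar> * t) \<le> z * w" if "0 \<le> w" "w \<le> t" for z w
        proof -
          have "\<bar>z * w\<bar> \<le> \<bar>z\<bar> * t" unfolding abs_mult using that by (intro mult_left_mono) auto
          then show ?thesis by linarith
        qed
        have "- (m * t) \<le> d * int x + e * int y + 2 * f * 1"
          using bd[of "int x" d] bd[of "int y" e] bd[of 1 "2 * f"] xy t1
          by (simp add: m_def abs_mult algebra_simps)
        then have "a * - (m * t) \<le> a * (d * int x + e * int y + 2 * f * 1)"
          using ac by (intro mult_left_mono) auto
        moreover have "a * (2 * int (P x y)) = t * t + a * (d * int x + e * int y + 2 * f * 1)"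
          unfolding P_eq t_def using discriminant_zero by algebra
        ultimately have 1: "t * (t - a * m) \<le> a * (2 * int (P x y))" by (simp add: algebra_simps)
        have "a * b * (2 * int j) - a * m = a * (2 * (b * int j) - m)" by (simp add: algebra_simps)
        then have 2: "a * (2 * (b * int j) - m) \<le> t - a * m" using t by (simp add: t_def)
        have "a * (2 * (b * int j - m)) \<le> a * (2 * (b * int j) - m)"
          using ac m by (intro mult_left_mono) auto
        with 2 have 3: "a * (2 * (b * int j - m)) \<le> t - a * m" by simp
        have "a * b * (2 * int j) * (a * (2 * (b * int j - m))) \<le> t * (t - a * m)"
          using t t1 3 bj j m ac by (intro mult_mono) (auto simp: t_def)
        with 1 have "a * (2 * int N) \<le> a * (2 * int (P x y))" by (simp add: N algebra_simps)
        then have "N \<le> P x y" using ac by simp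
        with P show False by simp
      qed
      then show "?g ` {(x, y). P x y < N \<and> True} \<subseteq> ?T \<times> {..<B} \<times> {..<A}"
        using AB0 by fastforce
    qed auto
    also have "\<dots> = card ?T * (B * A)" by (simp add: card_cartesian_product)
    also have "card ?T = j * (2 * j + 1)"
    proof -
      have "(\<Sum>u<n. n - u) * 2 = n * (n + 1)" for n :: nat
        by (induction n) (simp_all add: sum.lessThan_Suc_shift del: sum.lessThan_Suc)
      from this[of "2 * j"] show ?thesis by simp
    qed
    finally have "int N \<le> int (j * (2 * j + 1) * (B * A))" by linarith
    then have "(a * b * int j) * (2 * (b * int j - m)) \<le> (a * b * int j) * (2 * int j + 1)"
      by (simp add: N AB algebra_simps)
    moreover have "a * b * int j > 0" using ac b j m by simp
    ultimately have "2 * (b * int j - m) \<le> 2 * int j + 1" by (rule mult_left_le_imp_le)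
    moreover define z where "z = b * int j"
    ultimately have "2 * (z - m) \<le> 2 * int j + 1" by simp
    moreover have "z \<ge> 2 * int j" using bj by (simp add: z_def)
    ultimately show False using j by presburger
  qed
  with b show "b = 1" by simp
  with discriminant_zero have "a * c = 1" by simp
  then show "a = 1" "c = 1" using ac by (simp_all add: zmult_eq_1_iff)
qed

text \<open>\<open>P\<close> grows by \<open>E\<close> per step along an antidiagonal and by
  \<open>s + D\<close> from \<open>(s, 0)\<close> to \<open>(s + 1, 0)\<close>. Avoiding collisions
  forces \<open>E = 1\<close> and \<open>D \<ge> 1\<close>; attaining the values 0 and 1 then forces
  \<open>f = 0\<close> and \<open>D = 1\<close>.\<close>

lemma linear_coeffs:
  assumes "d < e"
  shows "d = 1 \<and> e = 3 \<and> f = 0"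
proof -
  have P: "2 * int (P x y) = (int x + int y)\<^sup>2 + d * int x + e * int y + 2 * f" for x y
    using P_eq[of x y] by (simp add: quadratic_coeffs power2_eq_square algebra_simps)
  define D where "D = int (P 1 0) - f"
  define E where "E = int (P 0 1) - int (P 1 0)"
  have d: "d = 2 * D - 1" using P[of 1 0] by (simp add: D_def)
  have e: "e = 2 * E + d" using P[of 0 1] P[of 1 0] by (simp add: E_def)
  have E: "E \<ge> 1" using assms e by simp
  have collision: False if "int s + D = E * int t" "t \<le> s" for s t
  proof -
    have "2 * int (P (s + 1) 0) - 2 * int (P (s - t) t) = 2 * (int s + D - E * int t)"
      unfolding P using that(2) by (simp add: d e of_nat_diff power2_eq_square algebra_simps)
    with that(1) have "P (s + 1) 0 = P (s - t) t" by simp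
    then have "s + 1 = s - t" using P_inj by blast
    then show False by simp
  qed
  have E1: "E = 1"
  proof (rule ccontr)
    assume "E \<noteq> 1"
    \<comment> \<open>For \<open>E \<ge> 2\<close> the choice \<open>t = \<bar>D\<bar>\<close>,
      \<open>s = E * \<bar>D\<bar> - D\<close> satisfies \<open>t \<le> s\<close> and yields a
      collision.\<close>
    with E have "2 * \<bar>D\<bar> \<le> E * \<bar>D\<bar>" by (intro mult_right_mono) auto
    then have "E * \<bar>D\<bar> - D \<ge> \<bar>D\<bar>" by linarith
    then have "int (nat (E * \<bar>D\<bar> - D)) = E * \<bar>D\<bar> - D" by linarith
    with \<open>E * \<bar>D\<bar> - D \<ge> \<bar>D\<bar>\<close> show False
      using collision[of "nat (E * \<bar>D\<bar> - D)" "nat \<bar>D\<bar>"] by (simp add: nat_mono)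
  qed
  have D1: "D \<ge> 1"
    using collision[of "nat (- D)" 0] by (cases "D \<ge> 1") auto
  have ge: "int (P x y) \<ge> f + (if x + y = 0 then 0 else D)" for x y
  proof -
    define s where "s = int x + int y"
    \<comment> \<open>The origin gives \<open>f\<close>, and every other point gives at least
      \<open>f + D\<close>.\<close>
    have "2 * int (P x y) = s * (s - 1) + 2 * (D * s) + 2 * int y + 2 * f"
      unfolding P s_def d e E1 by algebra
    moreover have "s * (s - 1) \<ge> 0" by (cases "s = 0") (auto simp: s_def)
    moreover have "D * s \<ge> D * (if x + y = 0 then 0 else 1)"
      using D1 by (intro mult_left_mono) (auto simp: s_def)
    ultimately show ?thesis by auto
  qed
  obtain x0 y0 where "P x0 y0 = 0" using P_surj by blast
  with ge[of x0 y0] P_00 D1 have f: "f = 0" by (auto split: if_splits)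
  obtain x1 y1 where xy1: "P x1 y1 = 1" using P_surj by blast
  then have "x1 + y1 \<noteq> 0" using P_00 f by (cases "x1 + y1 = 0") auto
  with ge[of x1 y1] xy1 f D1 have "D = 1" by (simp split: if_splits)
  with d e E1 f show ?thesis by simp
qed

theorem coeffs: "a = 1 \<and> b = 1 \<and> c = 1 \<and> f = 0 \<and> (d = 1 \<and> e = 3 \<or> d = 3 \<and> e = 1)"
proof -
  interpret sw: quadratic_pairing "\<lambda>x y. P y x" c b a e d f by (rule swap)
  have "d \<noteq> e"
  proof
    assume "d = e"
    then have "P 1 0 = P 0 1" using P_eq[of 1 0] P_eq[of 0 1] quadratic_coeffs by simp
    then show False using P_inj[of 1 0 0 1] by simp
  qed
  then show ?thesis using quadratic_coeffs linear_coeffs sw.linear_coeffs by (cases "d < e") auto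
qed

end

section \<open>The two Cantor polynomials on the sector\<close>

lemma bij_of_nat_Nats: "bij_betw real UNIV \<nat>"
  by (simp add: bij_betw_def Nats_def inj_on_def)

text \<open>In quadrant coordinates \<open>G1\<close> is this Cantor pairing function, and
  \<open>F1\<close> is the same with its arguments exchanged.\<close>

lemma of_nat_prod_encode:
  "real (prod_encode (m, n)) = (real m + real n) * (real m + real n + 1) / 2 + real m"
proof -
  have "real (triangle k) = real k * (real k + 1) / 2" for k
    by (induction k) (simp_all add: field_simps)
  then show ?thesis by (simp add: prod_encode_def)
qed

lemma packing_sector1_iff:
  "packing_polynomial_on sector1 p \<longleftrightarrow>
     bij_betw (\<lambda>(u, v). eval2 p (real u + real v) (real v)) UNIV \<nat>"
proof -
  have "bij_betw (\<lambda>(u, v). (u + v, v)) UNIV sector1"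
    by (rule bij_betw_byWitness[where f' = "\<lambda>(x, y). (x - y, y)"]) (auto simp: sector1_def)
  from bij_betw_comp_iff[OF this, of "\<lambda>(x, y). eval2 p (real x) (real y)" "\<nat>"]
  show ?thesis by (simp add: packing_polynomial_on_def comp_def case_prod_unfold)
qed

lemma packing_F1: "packing_polynomial_on sector1 F1"
proof -
  have "(\<lambda>(u, v). eval2 F1 (real u + real v) (real v)) = real \<circ> prod_encode \<circ> prod.swap"
    by (auto simp: eval2_F1 of_nat_prod_encode field_simps)
  then show ?thesis
    unfolding packing_sector1_iff
    using bij_betw_trans[OF bij_swap bij_betw_trans[OF bij_prod_encode bij_of_nat_Nats]]
    by (simp add: comp_assoc)
qed

lemma packing_G1: "packing_polynomial_on sector1 G1"
proof -
  have "(\<lambda>(u, v). eval2 G1 (real u + real v) (real v)) = real \<circ> prod_encode"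
    by (auto simp: eval2_G1 of_nat_prod_encode field_simps)
  then show ?thesis
    unfolding packing_sector1_iff using bij_betw_trans[OF bij_prod_encode bij_of_nat_Nats] by simp
qed

section \<open>Polynomials of total degree two\<close>

lemma total_degree_ge:
  assumes "coeff (coeff p j) i \<noteq> 0"
  shows "i + j \<le> total_degree p"
proof -
  let ?S = "{i + j | i j. coeff (coeff p j) i \<noteq> 0}"
  \<comment> \<open>\<open>Max\<close> bounds its elements only on a finite set, so the support has
    to be enclosed in a finite range first.\<close>
  have "?S \<subseteq> (\<Union>j\<le>degree p. (\<lambda>i. i + j) ` {..degree (coeff p j)})"
  proof clarify
    fix i j assume nz: "coeff (coeff p j) i \<noteq> 0"
    then have "j \<le> degree p" by (intro le_degree) auto
    moreover have "i \<le> degree (coeff p j)" using nz by (rule le_degree)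
    ultimately show "i + j \<in> (\<Union>j\<le>degree p. (\<lambda>i. i + j) ` {..degree (coeff p j)})" by blast
  qed
  then have "finite ?S" by (rule finite_subset) auto
  then show ?thesis unfolding total_degree_def using assms by (intro Max_ge) auto
qed

lemma quadratic_form:
  assumes "total_degree p \<le> 2"
  obtains q00 q10 q20 q01 q11 q02
  where "p = [:[:q00, q10, q20:], [:q01, q11:], [:q02:]:]"
proof
  have *: "coeff (coeff p j) i = 0" if "i + j > 2" for i j
    using total_degree_ge[of p j i] assms that by linarith
  let ?q = "\<lambda>i j. coeff (coeff p j) i"
  show "p = [:[:?q 0 0, ?q 1 0, ?q 2 0:], [:?q 0 1, ?q 1 1:], [:?q 0 2:]:]"
    by (intro poly_eqI) (auto simp: coeff_pCons * numeral_2_eq_2 split: nat.split)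
qed

lemma total_degree_quadratic:
  assumes "q20 \<noteq> 0"
  shows "total_degree [:[:q00, q10, q20:], [:q01, q11:], [:q02:]:] = 2"
  unfolding total_degree_def
proof (rule Max_eqI)
  let ?p = "[:[:q00, q10, q20:], [:q01, q11:], [:q02:]:]"
  have "i + j \<le> 2" if "coeff (coeff ?p j) i \<noteq> 0" for i j
    using that by (auto simp: coeff_pCons split: nat.splits)
  then have sub: "insert 0 {i + j | i j. coeff (coeff ?p j) i \<noteq> 0} \<subseteq> {..2}" by blast
  then show "k \<le> 2" if "k \<in> insert 0 {i + j | i j. coeff (coeff ?p j) i \<noteq> 0}" for k
    using that by blast
  show "finite (insert 0 {i + j | i j. coeff (coeff ?p j) i \<noteq> 0})"
    by (rule finite_subset[OF sub]) simp
  have "coeff (coeff ?p 0) 2 \<noteq> 0" using assms by (simp add: numeral_2_eq_2)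
  then show "2 \<in> insert 0 {i + j | i j. coeff (coeff ?p j) i \<noteq> 0}"
    by (intro insertI2 CollectI exI[of _ 2] exI[of _ 0]) simp
qed

text \<open>The padding zeros keep the six-coefficient shape of \<open>quadratic_form\<close>, to
  which \<open>total_degree_quadratic\<close> applies.\<close>

lemma F1_eq: "F1 = [:[:0, 1/2, 1/2:], [:1, 0:], [:0:]:]"
  by (simp add: F1_def varX_def varY_def one_pCons)

lemma G1_eq: "G1 = [:[:0, 3/2, 1/2:], [:-1, 0:], [:0:]:]"
  by (simp add: G1_def varX_def varY_def one_pCons)

lemma packing_quadratic_cases:
  assumes "packing_polynomial_on sector1 p" "total_degree p = 2"
  shows "p = F1 \<or> p = G1"
proof -
  obtain q00 q10 q20 q01 q11 q02 where p: "p = [:[:q00, q10, q20:], [:q01, q11:], [:q02:]:]"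
    using quadratic_form assms(2) by (metis order_refl)
  define g where "g u v = eval2 p (real u + real v) (real v)" for u v
  have bij: "bij_betw (\<lambda>(u, v). g u v) UNIV \<nat>"
    using assms(1) by (simp add: packing_sector1_iff g_def)
  \<comment> \<open>Rounding loses nothing, since \<open>g\<close> takes values in
    \<open>\<nat>\<close>.\<close>
  define P where "P u v = nat \<lfloor>g u v\<rfloor>" for u v
  have P: "real (P u v) = g u v" for u v
  proof -
    have "g u v \<in> \<nat>" using bij_betwE[OF bij] by auto
    then show ?thesis by (auto simp: P_def elim!: Nats_cases)
  qed
  have g: "g u v = q20 * (real u)\<^sup>2 + (2 * q20 + q11) * real u * real v
      + (q20 + q11 + q02) * (real v)\<^sup>2 + q10 * real u + (q10 + q01) * real v + q00" for u v
    by (simp add: g_def p eval2_def power2_eq_square algebra_simps)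
  \<comment> \<open>Finite differences at the origin recover the doubled coefficients and show that
    they are integers.\<close>
  define a b c d e f where
    "a = int (P 2 0) - 2 * int (P 1 0) + int (P 0 0)" and
    "b = int (P 1 1) - int (P 1 0) - int (P 0 1) + int (P 0 0)" and
    "c = int (P 0 2) - 2 * int (P 0 1) + int (P 0 0)" and
    "d = 4 * int (P 1 0) - int (P 2 0) - 3 * int (P 0 0)" and
    "e = 4 * int (P 0 1) - int (P 0 2) - 3 * int (P 0 0)" and
    "f = int (P 0 0)"
  have q: "2 * q20 = real_of_int a" "2 * q20 + q11 = real_of_int b"
    "2 * (q20 + q11 + q02) = real_of_int c" "2 * q10 = real_of_int d"
    "2 * (q10 + q01) = real_of_int e" "q00 = real_of_int f"
    by (simp_all add: a_def b_def c_def d_def e_def f_def P g)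
  interpret quadratic_pairing P a b c d e f
  proof
    fix x y x' y' n
    have "2 * real (P x y) = 2 * q20 * (real x)\<^sup>2 + 2 * (2 * q20 + q11) * real x * real y
      + 2 * (q20 + q11 + q02) * (real y)\<^sup>2 + 2 * q10 * real x + 2 * (q10 + q01) * real y + 2 * q00"
      by (simp add: P g algebra_simps)
    also have "\<dots> = real_of_int (a * int x ^ 2 + 2 * b * int x * int y + c * int y ^ 2
      + d * int x + e * int y + 2 * f)"
      using q by simp
    finally show "2 * int (P x y) = a * int x ^ 2 + 2 * b * int x * int y + c * int y ^ 2
      + d * int x + e * int y + 2 * f" by linarith
    show "x = x' \<and> y = y'" if "P x y = P x' y'"
      using bij_betw_imp_inj_on[OF bij] that P[of x y] P[of x' y']
      by (metis (mono_tags, lifting) case_prod_conv injD prod.inject)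
    have "real n \<in> (\<lambda>(u, v). g u v) ` UNIV" using bij_betw_imp_surj_on[OF bij] by simp
    then obtain u v where "real n = g u v" by auto
    then have "P u v = n" using P[of u v] by simp
    then show "\<exists>x y. P x y = n" by blast
  qed
  \<comment> \<open>The case \<open>d = 1\<close>, \<open>e = 3\<close> yields \<open>F1\<close>,
    and \<open>d = 3\<close>, \<open>e = 1\<close> yields \<open>G1\<close>.\<close>
  from coeffs show ?thesis using q
    by (auto simp: p F1_eq G1_eq)
qed

theorem theorem8:
  shows "quadratic_packing_polynomials sector1 = {F1, G1}"
proof
  show "quadratic_packing_polynomials sector1 \<subseteq> {F1, G1}"
    using packing_quadratic_cases by (auto simp: quadratic_packing_polynomials_def)
  have "total_degree F1 = 2" "total_degree G1 = 2"
    unfolding F1_eq G1_eq by (rule total_degree_quadratic; simp)+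
  then show "{F1, G1} \<subseteq> quadratic_packing_polynomials sector1"
    using packing_F1 packing_G1 by (simp add: quadratic_packing_polynomials_def)
qed

end
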